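(* Let $(\mathcal{C},\Omega,\mathfrak{P})$ be a measurable spined category, equipped with some S-functor $s:\mathcal{C}\to\mathrm{Nat}$. Let $\mathrm{pc}\,\mathcal{C}$ denote the class of pseudo-chordal objects of $\mathcal{C}$. Then the map $\Delta:\mathcal{C}\to\mathrm{Nat}$ defined on objects by $$\Delta[G]=\min\{\,s(H) \mid H\in \mathrm{pc}\,\mathcal{C},\ \mathcal{C}(G,H)\neq\emptyset\,\}$$ (1) is an S-functor; and (2) dominates all other S-functors, i.e. for every object $X$ of $\mathcal{C}$ and every S-functor $F:\mathcal{C}\to\mathrm{Nat}$ we have $F[X]\leq\Delta[X]$.
   Context: $\mathbb{N}$ denotes the natural numbers including $0$; $\mathcal{C}(X,Y)$ denotes the collection of morphisms $X\to Y$ in $\mathcal{C}$. **Spined category.** A spined category $(\mathcal{C},\Omega,\mathfrak{P})$ consists of a category $\mathcal{C}$ equipped with - a sequence $\Omega:\mathbb{N}\to\mathrm{ob}\,\mathcal{C}$, called the spine (write $\Omega_n$ for its $n$-th term); - an operation $\mathfrak{P}$, called the proxy pushout, that assigns to each diagram (span) $G\xleftarrow{g}\Omega_n\xrightarrow{h}H$ in $\mathcal{C}$ a distinguished cocone $G\xrightarrow{\mathfrak{P}(g,h)_g}\mathfrak{P}(g,h)\xleftarrow{\mathfrak{P}(g,h)_h}H$ (so $\mathfrak{P}(g,h)_g\circ g=\mathfrak{P}(g,h)_h\circ h$); subject to two conditions: - (SC1) for every $X\in\mathrm{ob}\,\mathcal{C}$ there is $n\in\mathbb{N}$ such that $\mathcal{C}(X,\Omega_n)\neq\emptyset$;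 - (SC2) given any diagram $G'\xleftarrow{g'}G\xleftarrow{g}\Omega_n\xrightarrow{h}H\xrightarrow{h'}H'$ there is a unique morphism $(g',h'):\mathfrak{P}(g,h)\to\mathfrak{P}(g'\circ g,h'\circ h)$ such that $(g',h')\circ\mathfrak{P}(g,h)_g=\mathfrak{P}(g'\circ g,h'\circ h)_{g'\circ g}\circ g'$ and $(g',h')\circ\mathfrak{P}(g,h)_h=\mathfrak{P}(g'\circ g,h'\circ h)_{h'\circ h}\circ h'$. **Spinal functor.** Given spined categories $(\mathcal{C},\Omega^{\mathcal{C}},\mathfrak{P}^{\mathcal{C}})$ and $(\mathcal{D},\Omega^{\mathcal{D}},\mathfrak{P}^{\mathcal{D}})$, a functor $F:\mathcal{C}\to\mathcal{D}$ is a spinal functor if - (SF1) it preserves the spine: $F[\Omega^{\mathcal{C}}_n]=\Omega^{\mathcal{D}}_n$ for all $n$; - (SF2) it preserves proxy pushouts: for every span $G\xleftarrow{g}\Omega^{\mathcal{C}}_n\xrightarrow{h}H$ in $\mathcal{C}$, one has $F[\mathfrak{P}^{\mathcal{C}}(g,h)]=\mathfrak{P}^{\mathcal{D}}(Fg,Fh)$, $F\mathfrak{P}^{\mathcal{C}}(g,h)_g=\mathfrak{P}^{\mathcal{D}}(Fg,Fh)_{Fg}$ and $F\mathfrak{P}^{\mathcal{C}}(g,h)_h=\mathfrak{P}^{\mathcal{D}}(Fg,Fh)_{Fh}$. **Nat.** $\mathrm{Nat}$ is the spined category given by the poset $(\mathbb{N},\leq)$ regarded as a category, with spine $\Omega_n=n$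 and with suprema (maxima) as proxy pushouts, i.e. the proxy pushout of $a\leftarrow n\to b$ is $\max(a,b)$. A functor into $\mathrm{Nat}$ is determined by its values on objects; a map on objects is called a functor (S-functor) when it is the object part of one. **S-functor, measurable.** An S-functor on a spined category $\mathcal{C}$ is a spinal functor $\mathcal{C}\to\mathrm{Nat}$. A spined category is measurable if there is at least one S-functor on it. **Pseudo-chordal object.** An object $X$ of a spined category $\mathcal{C}$ is pseudo-chordal if $F[X]=G[X]$ for any two S-functors $F,G:\mathcal{C}\to\mathrm{Nat}$. *)

theory Defs
  imports Main
begin

record ('o, 'a) cat =
  Ob   :: "'o set"
  Arr  :: "'a set"
  Dom  :: "'a \<Rightarrow> 'o"
  Cod  :: "'a \<Rightarrow> 'o"
  Id   :: "'o \<Rightarrow> 'a"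
  Comp :: "'a \<Rightarrow> 'a \<Rightarrow> 'a"  (infixl "\<odot>\<index>" 70)

definition Hom :: "('o, 'a, 'z) cat_scheme \<Rightarrow> 'o \<Rightarrow> 'o \<Rightarrow> 'a set" where
  "Hom C X Y = {f \<in> Arr C. Dom C f = X \<and> Cod C f = Y}"

text \<open>Composition is in applicative order: \<open>g \<odot>\<^bsub>C\<^esub> f\<close> is \<open>g\<close> after \<open>f\<close>, and is
  meaningful only when \<open>Dom C g = Cod C f\<close>. Only members of \<open>Ob C\<close> and \<open>Arr C\<close> matter.\<close>

locale category =
  fixes C (structure)
  assumes dom_closed: "f \<in> Arr C \<Longrightarrow> Dom C f \<in> Ob C"
    and cod_closed: "f \<in> Arr C \<Longrightarrow> Cod C f \<in> Ob C"
    and id_hom: "X \<in> Ob C \<Longrightarrow> Id C X \<in> Hom C X X"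
    and comp_hom: "\<lbrakk>f \<in> Hom C X Y; g \<in> Hom C Y Z\<rbrakk> \<Longrightarrow> g \<odot> f \<in> Hom C X Z"
    and id_left: "f \<in> Hom C X Y \<Longrightarrow> Id C Y \<odot> f = f"
    and id_right: "f \<in> Hom C X Y \<Longrightarrow> f \<odot> Id C X = f"
    and comp_assoc: "\<lbrakk>f \<in> Hom C W X; g \<in> Hom C X Y; h \<in> Hom C Y Z\<rbrakk>
      \<Longrightarrow> (h \<odot> g) \<odot> f = h \<odot> (g \<odot> f)"

text \<open>A span \<open>G \<leftarrow> \<Omega>\<^sub>n \<rightarrow> H\<close> is given by its two arrows \<open>g\<close>, \<open>h\<close>, which determine all
  the objects involved; \<open>PP C g h\<close> is the apex of the distinguished cocone, \<open>PPl C g h\<close> its leg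
  from \<open>G\<close> and \<open>PPr C g h\<close> its leg from \<open>H\<close>.\<close>

record ('o, 'a) spined_cat = "('o, 'a) cat" +
  Spine :: "nat \<Rightarrow> 'o"
  PP  :: "'a \<Rightarrow> 'a \<Rightarrow> 'o"
  PPl :: "'a \<Rightarrow> 'a \<Rightarrow> 'a"
  PPr :: "'a \<Rightarrow> 'a \<Rightarrow> 'a"

locale spined_category = category C
  for C :: "('o, 'a) spined_cat" (structure) +
  assumes spine_ob: "Spine C n \<in> Ob C"
    and PP_ob: "\<lbrakk>g \<in> Hom C (Spine C n) G; h \<in> Hom C (Spine C n) H\<rbrakk> \<Longrightarrow> PP C g h \<in> Ob C"
    and PPl_hom: "\<lbrakk>g \<in> Hom C (Spine C n) G; h \<in> Hom C (Spine C n) H\<rbrakk>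
      \<Longrightarrow> PPl C g h \<in> Hom C G (PP C g h)"
    and PPr_hom: "\<lbrakk>g \<in> Hom C (Spine C n) G; h \<in> Hom C (Spine C n) H\<rbrakk>
      \<Longrightarrow> PPr C g h \<in> Hom C H (PP C g h)"
    and PP_commutes: "\<lbrakk>g \<in> Hom C (Spine C n) G; h \<in> Hom C (Spine C n) H\<rbrakk>
      \<Longrightarrow> PPl C g h \<odot> g = PPr C g h \<odot> h"
    and SC1: "X \<in> Ob C \<Longrightarrow> \<exists>n. Hom C X (Spine C n) \<noteq> {}"
    and SC2: "\<lbrakk>g \<in> Hom C (Spine C n) G; h \<in> Hom C (Spine C n) H;
        g' \<in> Hom C G G'; h' \<in> Hom C H H'\<rbrakk>
      \<Longrightarrow> \<exists>!u. u \<in> Hom C (PP C g h) (PP C (g' \<odot> g) (h' \<odot> h))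
            \<and> u \<odot> PPl C g h = PPl C (g' \<odot> g) (h' \<odot> h) \<odot> g'
            \<and> u \<odot> PPr C g h = PPr C (g' \<odot> g) (h' \<odot> h) \<odot> h'"

locale cat_functor = C: category C + D: category D
  for C :: "('o, 'a, 'y) cat_scheme" and D :: "('p, 'b, 'z) cat_scheme" +
  fixes Fo :: "'o \<Rightarrow> 'p" and Fa :: "'a \<Rightarrow> 'b"
  assumes F_ob: "X \<in> Ob C \<Longrightarrow> Fo X \<in> Ob D"
    and F_hom: "f \<in> Hom C X Y \<Longrightarrow> Fa f \<in> Hom D (Fo X) (Fo Y)"
    and F_id: "X \<in> Ob C \<Longrightarrow> Fa (Id C X) = Id D (Fo X)"
    and F_comp: "\<lbrakk>f \<in> Hom C X Y; g \<in> Hom C Y Z\<rbrakk> \<Longrightarrow> Fa (g \<odot>\<^bsub>C\<^esub> f) = Fa g \<odot>\<^bsub>D\<^esub> Fa f"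

locale spinal_functor = C: spined_category C + D: spined_category D + cat_functor C D Fo Fa
  for C :: "('o, 'a) spined_cat" and D :: "('p, 'b) spined_cat"
    and Fo :: "'o \<Rightarrow> 'p" and Fa :: "'a \<Rightarrow> 'b" +
  assumes SF1: "Fo (Spine C n) = Spine D n"
    and SF2: "\<lbrakk>g \<in> Hom C (Spine C n) G; h \<in> Hom C (Spine C n) H\<rbrakk>
      \<Longrightarrow> Fo (PP C g h) = PP D (Fa g) (Fa h)
        \<and> Fa (PPl C g h) = PPl D (Fa g) (Fa h)
        \<and> Fa (PPr C g h) = PPr D (Fa g) (Fa h)"

text \<open>In the poset category of the naturals, the unique arrow \<open>a \<rightarrow> b\<close> (for \<open>a \<le> b\<close>) is the
  pair \<open>(a, b)\<close>.\<close>

definition NatCat :: "(nat, nat \<times> nat) spined_cat" where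
  "NatCat = \<lparr>
     Ob = UNIV,
     Arr = {(a, b). a \<le> b},
     Dom = fst,
     Cod = snd,
     Id = (\<lambda>n. (n, n)),
     Comp = (\<lambda>g f. (fst f, snd g)),
     Spine = (\<lambda>n. n),
     PP = (\<lambda>g h. max (snd g) (snd h)),
     PPl = (\<lambda>g h. (snd g, max (snd g) (snd h))),
     PPr = (\<lambda>g h. (snd h, max (snd g) (snd h)))\<rparr>"

lemma spined_category_NatCat: "spined_category NatCat"
  by unfold_locales (auto simp: NatCat_def Hom_def)

definition S_functor :: "('o, 'a) spined_cat \<Rightarrow> ('o \<Rightarrow> nat) \<Rightarrow> bool" where
  "S_functor C F \<longleftrightarrow> (\<exists>Fa. spinal_functor C NatCat F Fa)"

definition measurable_spined_category :: "('o, 'a) spined_cat \<Rightarrow> bool" where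
  "measurable_spined_category C \<longleftrightarrow> spined_category C \<and> (\<exists>F. S_functor C F)"

definition pseudo_chordal :: "('o, 'a) spined_cat \<Rightarrow> 'o set" where
  "pseudo_chordal C =
     {X \<in> Ob C. \<forall>F G. S_functor C F \<longrightarrow> S_functor C G \<longrightarrow> F X = G X}"

definition Delta_values :: "('o, 'a) spined_cat \<Rightarrow> ('o \<Rightarrow> nat) \<Rightarrow> 'o \<Rightarrow> nat set" where
  "Delta_values C s G = {s H | H. H \<in> pseudo_chordal C \<and> Hom C G H \<noteq> {}}"

text \<open>The set of values may be infinite, so \<open>Min\<close> is not applicable. \<open>LEAST\<close> is the minimum
  provided the set is nonempty.\<close>

definition Delta :: "('o, 'a) spined_cat \<Rightarrow> ('o \<Rightarrow> nat) \<Rightarrow> 'o \<Rightarrow> nat" where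
  "Delta C s G = (LEAST k. k \<in> Delta_values C s G)"

end

theory Submission imports Defs begin

text \<open>Pseudo-chordal objects contain the spine and are closed under proxy pushouts, since an
  S-functor is determined on a proxy pushout by its values on the two feet. Hence if \<open>G \<rightarrow> G'\<close> and
  \<open>H \<rightarrow> H'\<close> attain the minima defining \<open>\<Delta>[G]\<close> and \<open>\<Delta>[H]\<close>, then (SC2) maps \<open>PP(g, h)\<close> to a
  pseudo-chordal object on which \<open>s\<close> takes the value \<open>max (\<Delta>[G]) (\<Delta>[H])\<close>. Domination holds because
  all S-functors agree with \<open>s\<close> at the pseudo-chordal object attaining \<open>\<Delta>[X]\<close>.\<close>

text \<open>\<open>NatCat\<close> is thin: an arrow is the pair of its endpoints, so an arrow part
  exists exactly when the object map is monotone along nonempty hom-sets, and the equations for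
  identities, composites and cocone legs then hold automatically. This reduces S-functors to three
  conditions on objects.\<close>

lemma S_functor_iff:
  assumes "spined_category C"
  shows "S_functor C F \<longleftrightarrow>
    (\<forall>n. F (Spine C n) = n) \<and>
    (\<forall>X Y. Hom C X Y \<noteq> {} \<longrightarrow> F X \<le> F Y) \<and>
    (\<forall>n G H g h. g \<in> Hom C (Spine C n) G \<longrightarrow> h \<in> Hom C (Spine C n) H \<longrightarrow>
      F (PP C g h) = max (F G) (F H))"
    (is "_ \<longleftrightarrow> ?spine \<and> ?mono \<and> ?PP")
proof (intro iffI)
  assume "S_functor C F"
  then obtain Fa where "spinal_functor C NatCat F Fa"
    by (auto simp: S_functor_def)
  then interpret F: spinal_functor C NatCat F Fa .
  have arr: "Fa f = (F X, F Y) \<and> F X \<le> F Y" if "f \<in> Hom C X Y" for f X Y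
    using F.F_hom[OF that] by (auto simp: NatCat_def Hom_def)
  have ?spine
    using F.SF1 by (simp add: NatCat_def)
  moreover have ?mono
    using arr by blast
  moreover have ?PP
    using F.SF2 arr by (fastforce simp: NatCat_def)
  ultimately show "?spine \<and> ?mono \<and> ?PP" by blast
next
  assume *: "?spine \<and> ?mono \<and> ?PP"
  interpret C: spined_category C by fact
  interpret N: spined_category NatCat by (rule spined_category_NatCat)
  \<comment> \<open>The only possible arrow part on arrows of \<open>C\<close>, since the endpoints
    are prescribed by \<open>F\<close>.\<close>
  define Fa where "Fa f = (F (Dom C f), F (Cod C f))" for f
  have arr: "Fa f = (F X, F Y)" if "f \<in> Hom C X Y" for f X Y
    using that by (simp add: Fa_def Hom_def)
  have "spinal_functor C NatCat F Fa"
  proof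
    show "F X \<in> Ob NatCat" for X
      by (simp add: NatCat_def)
    show "Fa f \<in> Hom NatCat (F X) (F Y)" if "f \<in> Hom C X Y" for f X Y
    proof -
      have "F X \<le> F Y" using that * by blast
      then show ?thesis using arr[OF that] by (simp add: NatCat_def Hom_def)
    qed
    show "Fa (Id C X) = Id NatCat (F X)" if "X \<in> Ob C" for X
      using arr[OF C.id_hom[OF that]] by (simp add: NatCat_def)
    show "Fa (g \<odot>\<^bsub>C\<^esub> f) = Fa g \<odot>\<^bsub>NatCat\<^esub> Fa f"
      if "f \<in> Hom C X Y" "g \<in> Hom C Y Z" for f g X Y Z
      using arr[OF C.comp_hom[OF that]] arr[OF that(1)] arr[OF that(2)]
      by (simp add: NatCat_def)
    show "F (Spine C n) = Spine NatCat n" for n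
      using * by (simp add: NatCat_def)
    show "F (PP C g h) = PP NatCat (Fa g) (Fa h)
        \<and> Fa (PPl C g h) = PPl NatCat (Fa g) (Fa h)
        \<and> Fa (PPr C g h) = PPr NatCat (Fa g) (Fa h)"
      if gh: "g \<in> Hom C (Spine C n) G" "h \<in> Hom C (Spine C n) H" for g h n G H
    proof -
      have "F (PP C g h) = max (F G) (F H)" using * gh by blast
      then show ?thesis
        using arr[OF gh(1)] arr[OF gh(2)] arr[OF C.PPl_hom[OF gh]] arr[OF C.PPr_hom[OF gh]]
        by (simp add: NatCat_def)
    qed
  qed
  then show "S_functor C F" by (auto simp: S_functor_def)
qed

context spined_category
begin

lemma S_functor_spine: "S_functor C F \<Longrightarrow> F (Spine C n) = n"
  using S_functor_iff[OF spined_category_axioms] by blast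

lemma S_functor_mono: "\<lbrakk>S_functor C F; f \<in> Hom C X Y\<rbrakk> \<Longrightarrow> F X \<le> F Y"
  using S_functor_iff[OF spined_category_axioms] by blast

lemma S_functor_PP:
  "\<lbrakk>S_functor C F; g \<in> Hom C (Spine C n) G; h \<in> Hom C (Spine C n) H\<rbrakk>
    \<Longrightarrow> F (PP C g h) = max (F G) (F H)"
  using S_functor_iff[OF spined_category_axioms] by blast

lemma Spine_pseudo_chordal: "Spine C n \<in> pseudo_chordal C"
  by (simp add: pseudo_chordal_def spine_ob S_functor_spine)

lemma PP_pseudo_chordal:
  assumes gh: "g \<in> Hom C (Spine C n) G" "h \<in> Hom C (Spine C n) H"
    and pc: "G \<in> pseudo_chordal C" "H \<in> pseudo_chordal C"
  shows "PP C g h \<in> pseudo_chordal C"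
proof -
  have "F (PP C g h) = F' (PP C g h)" if "S_functor C F" "S_functor C F'" for F F'
  proof -
    have "F G = F' G" "F H = F' H"
      using pc that unfolding pseudo_chordal_def by blast+
    then show ?thesis
      using S_functor_PP[OF that(1) gh] S_functor_PP[OF that(2) gh] by simp
  qed
  then show ?thesis
    using PP_ob[OF gh] by (auto simp: pseudo_chordal_def)
qed

text \<open>(SC1) provides an arrow from \<open>G\<close> to a spine object, which is
  pseudo-chordal. This makes the \<open>LEAST\<close> in \<open>Delta\<close> a genuine
  minimum.\<close>

lemma Delta_values_nonempty:
  assumes "G \<in> Ob C"
  shows "Delta_values C s G \<noteq> {}"
  using SC1[OF assms] Spine_pseudo_chordal by (auto simp: Delta_values_def)

lemma Delta_le:
  assumes "H \<in> pseudo_chordal C" "f \<in> Hom C G H"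
  shows "Delta C s G \<le> s H"
  unfolding Delta_def by (rule Least_le) (use assms in \<open>auto simp: Delta_values_def\<close>)

lemma Delta_attained:
  assumes "G \<in> Ob C"
  obtains H f where "H \<in> pseudo_chordal C" "f \<in> Hom C G H" "Delta C s G = s H"
proof -
  have "Delta C s G \<in> Delta_values C s G"
    unfolding Delta_def using Delta_values_nonempty[OF assms, of s] by (metis LeastI ex_in_conv)
  then show thesis
    using that by (auto simp: Delta_values_def)
qed

text \<open>Precomposing with \<open>f\<close> turns an arrow from \<open>Y\<close> to an optimal
  pseudo-chordal object into an arrow from \<open>X\<close> to the same object.\<close>

lemma Delta_mono:
  assumes "f \<in> Hom C X Y"
  shows "Delta C s X \<le> Delta C s Y"
proof -
  have "Y \<in> Ob C" using assms cod_closed by (auto simp: Hom_def)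
  then obtain H k where "H \<in> pseudo_chordal C" "k \<in> Hom C Y H" "Delta C s Y = s H"
    by (rule Delta_attained)
  then show ?thesis
    using Delta_le comp_hom[OF assms] by metis
qed

lemma S_functor_le_Delta:
  assumes "S_functor C s" "S_functor C F" "X \<in> Ob C"
  shows "F X \<le> Delta C s X"
proof -
  obtain H f where H: "H \<in> pseudo_chordal C" "f \<in> Hom C X H" "Delta C s X = s H"
    using Delta_attained[OF assms(3)] .
  then have "F H = s H"
    using assms by (auto simp: pseudo_chordal_def)
  then show ?thesis
    using S_functor_mono[OF assms(2) H(2)] H(3) by simp
qed

lemma Delta_spine:
  assumes "S_functor C s"
  shows "Delta C s (Spine C n) = n"
proof (rule antisym)
  \<comment> \<open>The spine object is itself an admissible target, reached by its
    identity.\<close>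
  show "Delta C s (Spine C n) \<le> n"
    using Delta_le[OF Spine_pseudo_chordal id_hom[OF spine_ob]] S_functor_spine[OF assms] by metis
  \<comment> \<open>Domination is applied to the S-functor \<open>s\<close> itself.\<close>
  show "n \<le> Delta C s (Spine C n)"
    using S_functor_le_Delta[OF assms assms spine_ob] S_functor_spine[OF assms] by metis
qed

lemma Delta_PP:
  assumes s: "S_functor C s"
    and gh: "g \<in> Hom C (Spine C n) G" "h \<in> Hom C (Spine C n) H"
  shows "Delta C s (PP C g h) = max (Delta C s G) (Delta C s H)"
proof (rule antisym)
  have "G \<in> Ob C" "H \<in> Ob C"
    using gh cod_closed by (auto simp: Hom_def)
  then obtain G' g' H' h' where G': "G' \<in> pseudo_chordal C" "g' \<in> Hom C G G'" "Delta C s G = s G'"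
    and H': "H' \<in> pseudo_chordal C" "h' \<in> Hom C H H'" "Delta C s H = s H'"
    by (metis Delta_attained)
  \<comment> \<open>The composites form a span on the same spine object with the pseudo-chordal feet
    \<open>G'\<close> and \<open>H'\<close>, so its proxy pushout is pseudo-chordal.\<close>
  note gh' = comp_hom[OF gh(1) G'(2)] comp_hom[OF gh(2) H'(2)]
  obtain u where "u \<in> Hom C (PP C g h) (PP C (g' \<odot> g) (h' \<odot> h))"
    using SC2[OF gh G'(2) H'(2)] by blast
  then have "Delta C s (PP C g h) \<le> s (PP C (g' \<odot> g) (h' \<odot> h))"
    by (rule Delta_le[OF PP_pseudo_chordal[OF gh' G'(1) H'(1)]])
  then show "Delta C s (PP C g h) \<le> max (Delta C s G) (Delta C s H)"
    using S_functor_PP[OF s gh'] G'(3) H'(3) by simp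
  \<comment> \<open>Here only monotonicity along the two legs of the cocone is needed.\<close>
  show "max (Delta C s G) (Delta C s H) \<le> Delta C s (PP C g h)"
    using Delta_mono[OF PPl_hom[OF gh]] Delta_mono[OF PPr_hom[OF gh]] by simp
qed

lemma S_functor_Delta:
  assumes "S_functor C s"
  shows "S_functor C (Delta C s)"
  unfolding S_functor_iff[OF spined_category_axioms]
  using Delta_spine[OF assms] Delta_mono Delta_PP[OF assms] by blast

end

theorem theorem2p2:
  fixes C :: "('o, 'a) spined_cat" and s :: "'o \<Rightarrow> nat"
  assumes "measurable_spined_category C"
    and "S_functor C s"
  shows "(\<forall>G \<in> Ob C. Delta_values C s G \<noteq> {})
    \<and> S_functor C (Delta C s)
    \<and> (\<forall>X \<in> Ob C. \<forall>F. S_functor C F \<longrightarrow> F X \<le> Delta C s X)"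
proof -
  interpret spined_category C
    using assms(1) by (simp add: measurable_spined_category_def)
  show ?thesis
    using Delta_values_nonempty S_functor_Delta S_functor_le_Delta assms(2) by blast
qed

end
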